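(* Let $1\le \ell\le d$ be integers and let $(\mathbf{P}_k)_{k\ge 0}$ be i.i.d. random matrices in $\mathbb{R}^{d\times \ell}$ such that $\mathbb{E}\,\mathbf{P}_k\mathbf{P}_k^\top=\mathbf{I}_d$ and $\mathbf{P}_k^\top\mathbf{P}_k=(d/\ell)\,\mathbf{I}_\ell$. Let $f:\mathbb{R}^d\to\mathbb{R}$ be continuously differentiable with $\lambda$-Lipschitz gradient ($\lambda>0$), suppose $f$ attains its minimum $f_*$, and suppose that for some $0<\gamma\le\lambda$ the Polyak-Lojasiewicz inequality $$f(\mathbf{x})-f_*\le \frac{\|\nabla f(\mathbf{x})\|^2}{2\gamma}\qquad\text{for all }\mathbf{x}\in\mathbb{R}^d$$ holds. Let $\mathbf{x}_0\in\mathbb{R}^d$ be an arbitrary (deterministic) initialization, let $0<\alpha<2\ell/(d\lambda)$, and define $$\mathbf{x}_{k+1}=\mathbf{x}_k-\alpha\,\mathbf{P}_k\mathbf{P}_k^\top\nabla f(\mathbf{x}_k),\qquad k\ge 0.$$ Then $f(\mathbf{x}_k)\to f_*$ almost surely and $f(\mathbf{x}_k)\to f_*$ in $L^1$ as $k\to\infty$.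
   Context: $\|\cdot\|$ is the Euclidean norm on $\mathbb{R}^d$, and $\mathbf{I}_n$ is the $n\times n$ identity matrix. *)

theory Defs
  imports "HOL-Probability.Probability"
begin

end

theory Submission
  imports Defs
begin

text \<open>The descent lemma and the constraint \<open>P\<^sup>T P = (d/l) I\<close> give, with
  \<open>c = \<alpha> - \<lambda> \<alpha>\<^sup>2 d / (2 l) > 0\<close>, the almost sure bound
  \<open>f (x\<^bsub>k+1\<^esub>) \<le> f (x\<^sub>k) - c \<bar>P\<^sup>T \<nabla>f (x\<^sub>k)\<bar>\<^sup>2\<close>. Since \<open>P\<^sub>k\<close> is independent of
  \<open>x\<^sub>k\<close> and \<open>E P P\<^sup>T = I\<close>, the expected decrease is \<open>c E \<bar>\<nabla>f (x\<^sub>k)\<bar>\<^sup>2\<close>, so by the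
  Polyak-Lojasiewicz inequality the expected gap \<open>E (f (x\<^sub>k) - f\<^sub>*)\<close> decays geometrically. The
  expected gaps are therefore summable, hence the gaps are almost surely summable and tend to 0.\<close>

section \<open>Functions with Lipschitz gradient: quadratic upper bound and gradient bound\<close>

lemma lipschitz_gradient_descent:
  fixes f :: "'a::real_inner \<Rightarrow> real"
  assumes grad: "\<And>x. GDERIV f x :> g x" and lip: "L-lipschitz_on UNIV g"
  shows "f y \<le> f x + inner (g x) (y - x) + L / 2 * (norm (y - x))\<^sup>2"
proof -
  define v where "v = y - x"
  \<comment> \<open>Since \<open>h 0 = f x\<close>, the claim is exactly
    \<open>h 1 \<le> h 0\<close>. The quadratic term is chosen so that its derivative
    \<open>L * t * (norm v)\<^sup>2\<close> is the Cauchy-Schwarz and Lipschitz bound on the change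
    of the directional derivative.\<close>
  define h where "h t = f (x + t *\<^sub>R v) - t * inner (g x) v - L / 2 * t\<^sup>2 * (norm v)\<^sup>2" for t
  have der: "(h has_real_derivative inner (g (x + t *\<^sub>R v)) v - inner (g x) v - L * t * (norm v)\<^sup>2) (at t)" for t
  proof -
    have "((\<lambda>s. x + s *\<^sub>R v) has_derivative (\<lambda>s. s *\<^sub>R v)) (at t)"
      by (auto intro!: derivative_eq_intros)
    from has_derivative_compose[OF this grad[unfolded gderiv_def]]
    have "((\<lambda>s. f (x + s *\<^sub>R v)) has_real_derivative inner (g (x + t *\<^sub>R v)) v) (at t)"
      unfolding has_field_derivative_def
      by (rule has_derivative_eq_rhs) (simp add: fun_eq_iff inner_commute)
    then show ?thesis
      unfolding h_def by (auto intro!: derivative_eq_intros)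
  qed
  have "h 1 \<le> h 0"
  proof (rule DERIV_nonpos_imp_nonincreasing[of 0 1 h])
    fix t :: real assume t: "0 \<le> t" "t \<le> 1"
    have "inner (g (x + t *\<^sub>R v) - g x) v \<le> norm (g (x + t *\<^sub>R v) - g x) * norm v"
      by (rule norm_cauchy_schwarz)
    also have "\<dots> \<le> (L * (t * norm v)) * norm v"
      using lipschitz_onD[OF lip UNIV_I UNIV_I, of "x + t *\<^sub>R v" x] t
      by (intro mult_right_mono) (auto simp: dist_norm)
    finally have "inner (g (x + t *\<^sub>R v)) v - inner (g x) v - L * t * (norm v)\<^sup>2 \<le> 0"
      by (simp add: inner_diff_left power2_eq_square algebra_simps)
    with der show "\<exists>y. (h has_real_derivative y) (at t) \<and> y \<le> 0" by blast
  qed simp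
  then show ?thesis by (simp add: h_def v_def)
qed

text \<open>A gradient step of size \<open>1 / L\<close>, which minimizes the quadratic upper bound,
  lowers \<open>f\<close> by at least \<open>(norm (g x))\<^sup>2 / (2 * L)\<close> and still cannot
  get below \<open>m\<close>. This later turns a bound on the gaps into a bound on the
  gradients.\<close>

lemma lipschitz_gradient_norm_le:
  fixes f :: "'a::real_inner \<Rightarrow> real"
  assumes grad: "\<And>x. GDERIV f x :> g x" and lip: "L-lipschitz_on UNIV g" and "0 < L"
    and min: "\<And>x. m \<le> f x"
  shows "(norm (g x))\<^sup>2 \<le> 2 * L * (f x - m)"
proof -
  have "m \<le> f (x - (1 / L) *\<^sub>R g x)" by (rule min)
  also have "\<dots> \<le> f x - (norm (g x))\<^sup>2 / (2 * L)"
    using lipschitz_gradient_descent[OF grad lip, of "x - (1 / L) *\<^sub>R g x" x] \<open>0 < L\<close>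
    by (simp add: dot_square_norm power_mult_distrib power2_eq_square divide_simps)
  finally show ?thesis using \<open>0 < L\<close> by (simp add: field_simps)
qed

section \<open>The quadratic form and the norm of a Gram matrix\<close>

lemma inner_gram:
  fixes A :: "real ^ 'n ^ 'm"
  shows "inner ((A ** transpose A) *v x) x = (norm (transpose A *v x))\<^sup>2"
proof -
  have "inner ((A ** transpose A) *v x) x = inner x (A *v (transpose A *v x))"
    by (simp add: matrix_vector_mul_assoc inner_commute del: transpose_matrix_vector)
  also have "\<dots> = inner (x v* A) (transpose A *v x)"
    by (rule dot_lmul_matrix[symmetric])
  finally show ?thesis by (simp add: power2_norm_eq_inner)
qed

text \<open>The columns of \<open>A\<close> are orthogonal with squared length \<open>s\<close>, so
  \<open>A\<close> multiplies squared norms by \<open>s\<close>; apply this to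
  \<open>transpose A *v x\<close>. In the descent lemma it makes the quadratic term a multiple of
  the linear one.\<close>

lemma norm_gram:
  fixes A :: "real ^ 'n ^ 'm"
  assumes "transpose A ** A = s *\<^sub>R mat 1"
  shows "(norm ((A ** transpose A) *v x))\<^sup>2 = s * inner ((A ** transpose A) *v x) x"
proof -
  define w where "w = transpose A *v x"
  have "(norm ((A ** transpose A) *v x))\<^sup>2 = inner (A *v w) (A *v w)"
    by (simp add: w_def power2_norm_eq_inner matrix_vector_mul_assoc del: transpose_matrix_vector)
  also have "\<dots> = inner ((A *v w) v* A) w"
    by (rule dot_lmul_matrix[symmetric])
  also have "(A *v w) v* A = (transpose A ** A) *v w"
    by (simp add: matrix_vector_mul_assoc[symmetric])
  also have "\<dots> = s *\<^sub>R w"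
    unfolding assms by (simp add: scaleR_matrix_vector_assoc[symmetric])
  finally show ?thesis
    by (simp add: inner_gram w_def power2_norm_eq_inner)
qed

section \<open>Independence in random recursions, random quadratic forms, summable
  expectations\<close>

context prob_space
begin

text \<open>\<^const>\<open>indep_var\<close> only relates random variables of one type, so the independence of
  \<open>\<xi> k\<close> and \<open>X k\<close> is expressed through their images in a common space.\<close>

lemma
  fixes \<xi> :: "nat \<Rightarrow> 'a \<Rightarrow> 'b" and X :: "nat \<Rightarrow> 'a \<Rightarrow> 'c"
  assumes ind: "indep_vars (\<lambda>_. N) \<xi> UNIV"
    and step: "(\<lambda>(p, x). T p x) \<in> measurable (N \<Otimes>\<^sub>M K) K" and "x0 \<in> space K"
    and X_0: "\<And>\<omega>. \<omega> \<in> space M \<Longrightarrow> X 0 \<omega> = x0"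
    and X_Suc: "\<And>k \<omega>. \<omega> \<in> space M \<Longrightarrow> X (Suc k) \<omega> = T (\<xi> k \<omega>) (X k \<omega>)"
  shows random_variable_random_recursion: "random_variable K (X k)"
    and indep_var_random_recursion: "F \<in> measurable N L \<Longrightarrow> H \<in> measurable K L \<Longrightarrow>
      indep_var L (\<lambda>\<omega>. F (\<xi> k \<omega>)) L (\<lambda>\<omega>. H (X k \<omega>))"
proof -
  \<comment> \<open>The state after \<open>k\<close> steps as a deterministic function of the noise;
    it reads only the indices below \<open>k\<close>. With \<open>k\<close> fixed, all states up to
    time \<open>k\<close> live on one product space, which allows induction on
    \<open>j\<close>.\<close>
  define \<phi> where "\<phi> k p = rec_nat x0 (\<lambda>j. T (p j)) k" for k and p :: "nat \<Rightarrow> 'b"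
  have X_eq: "X j \<omega> = \<phi> j (restrict (\<lambda>i. \<xi> i \<omega>) {..<k})" if "\<omega> \<in> space M" "j \<le> k" for \<omega> j
    using that(2) by (induction j) (simp_all add: X_0 X_Suc that(1) \<phi>_def)
  have meas: "\<phi> j \<in> measurable (PiM {..<k} (\<lambda>_. N)) K" if "j \<le> k" for j
    using that
  proof (induction j)
    case 0
    then show ?case using \<open>x0 \<in> space K\<close> by (simp add: \<phi>_def[abs_def])
  next
    case (Suc j)
    have "(\<lambda>p. (p j, \<phi> j p)) \<in> measurable (PiM {..<k} (\<lambda>_. N)) (N \<Otimes>\<^sub>M K)"
      using Suc by (intro measurable_Pair measurable_component_singleton) auto
    from measurable_compose[OF this step] show ?case
      by (simp add: \<phi>_def[abs_def])
  qed
  \<comment> \<open>The recursion determines \<open>X k\<close> only on \<open>space M\<close>, so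
    the results are first shown for \<open>Z\<close>, which follows the noise formula
    everywhere.\<close>
  define Z where "Z \<omega> = \<phi> k (restrict (\<lambda>i. \<xi> i \<omega>) {..<k})" for \<omega>
  have XZ: "X k \<omega> = Z \<omega>" if "\<omega> \<in> space M" for \<omega>
    using X_eq[OF that order_refl] by (simp add: Z_def)
  \<comment> \<open>The blocks \<open>{k}\<close> and \<open>{..<k}\<close> are disjoint: step
    \<open>k\<close> uses fresh noise.\<close>
  have pair: "indep_var (PiM {k} (\<lambda>_. N)) (\<lambda>\<omega>. restrict (\<lambda>i. \<xi> i \<omega>) {k})
      (PiM {..<k} (\<lambda>_. N)) (\<lambda>\<omega>. restrict (\<lambda>i. \<xi> i \<omega>) {..<k})"
    by (rule indep_var_restrict[OF ind]) auto
  have "random_variable K Z"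
    using measurable_compose[OF indep_var_rv2[OF pair] meas[OF order_refl]] by (simp add: Z_def[abs_def])
  then show "random_variable K (X k)"
    using XZ by (simp cong: measurable_cong)
  show "indep_var L (\<lambda>\<omega>. F (\<xi> k \<omega>)) L (\<lambda>\<omega>. H (X k \<omega>))"
    if F: "F \<in> measurable N L" and H: "H \<in> measurable K L"
  proof -
    have "indep_var L (\<lambda>\<omega>. F (\<xi> k \<omega>)) L (\<lambda>\<omega>. H (Z \<omega>))"
      using indep_var_compose[OF pair measurable_compose[OF measurable_component_singleton[of k] F]
          measurable_compose[OF meas[OF order_refl] H]]
      by (simp add: o_def Z_def[abs_def])
    \<comment> \<open>Independence means measurability plus a joint law equal to the product of the
      marginals; all of this depends only on values on \<open>space M\<close>.\<close>
    moreover have "random_variable L (\<lambda>\<omega>. H (X k \<omega>)) \<longleftrightarrow> random_variable L (\<lambda>\<omega>. H (Z \<omega>))"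
      by (intro measurable_cong) (simp add: XZ)
    moreover have "distr M L (\<lambda>\<omega>. H (X k \<omega>)) = distr M L (\<lambda>\<omega>. H (Z \<omega>))"
      by (intro distr_cong) (simp_all add: XZ)
    moreover have "distr M (L \<Otimes>\<^sub>M L) (\<lambda>\<omega>. (F (\<xi> k \<omega>), H (X k \<omega>)))
        = distr M (L \<Otimes>\<^sub>M L) (\<lambda>\<omega>. (F (\<xi> k \<omega>), H (Z \<omega>)))"
      by (intro distr_cong) (simp_all add: XZ)
    ultimately show ?thesis unfolding indep_var_distribution_eq by simp
  qed
qed

text \<open>The form is a finite sum of products of an entry of \<open>A\<close> with some
  \<open>Y_i Y_j\<close>. Each product has independent integrable factors, the second by
  boundedness, so its expectation factors.\<close>

lemma
  fixes A :: "'a \<Rightarrow> real ^ 'n ^ 'n" and Y :: "'a \<Rightarrow> real ^ 'n"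
  assumes ind: "\<And>i j. indep_var borel (\<lambda>\<omega>. A \<omega> $ i $ j) borel (\<lambda>\<omega>. Y \<omega> $ i * Y \<omega> $ j)"
    and A: "integrable M A" and Y: "random_variable borel Y"
    and bounded: "AE \<omega> in M. norm (Y \<omega>) \<le> B"
  shows integrable_quadratic_form_indep: "integrable M (\<lambda>\<omega>. inner (A \<omega> *v Y \<omega>) (Y \<omega>))"
    and expectation_quadratic_form_indep:
      "expectation (\<lambda>\<omega>. inner (A \<omega> *v Y \<omega>) (Y \<omega>)) = expectation (\<lambda>\<omega>. inner (expectation A *v Y \<omega>) (Y \<omega>))"
proof -
  have entry: "bounded_linear (\<lambda>A :: real ^ 'n ^ 'n. A $ i $ j)" for i j
    by (intro bounded_linear_compose[OF bounded_linear_vec_nth bounded_linear_vec_nth])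
  have expand: "inner (A *v y) y = (\<Sum>i\<in>UNIV. \<Sum>j\<in>UNIV. A $ i $ j * (y $ i * y $ j))"
    for A :: "real ^ 'n ^ 'n" and y
    by (simp add: inner_vec_def matrix_vector_mult_def sum_distrib_right sum_distrib_left mult_ac)
  have intA: "integrable M (\<lambda>\<omega>. A \<omega> $ i $ j)" for i j
    using integrable_bounded_linear[OF entry A] .
  have intY: "integrable M (\<lambda>\<omega>. Y \<omega> $ i * Y \<omega> $ j)" for i j
  proof (rule integrable_const_bound)
    show "AE \<omega> in M. norm (Y \<omega> $ i * Y \<omega> $ j) \<le> B * B"
      using bounded
    proof eventually_elim
      case (elim \<omega>)
      then have "\<bar>Y \<omega> $ i\<bar> \<le> B" "\<bar>Y \<omega> $ j\<bar> \<le> B"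
        using component_le_norm_cart[of "Y \<omega>"] by (meson order_trans)+
      then show ?case by (simp add: abs_mult mult_mono)
    qed
    show "(\<lambda>\<omega>. Y \<omega> $ i * Y \<omega> $ j) \<in> borel_measurable M"
      by (rule measurable_compose[OF Y]) (intro borel_measurable_continuous_onI continuous_intros)
  qed
  note int = indep_var_integrable[OF ind intA intY]
  show "integrable M (\<lambda>\<omega>. inner (A \<omega> *v Y \<omega>) (Y \<omega>))"
    unfolding expand by (intro Bochner_Integration.integrable_sum int)
  show "expectation (\<lambda>\<omega>. inner (A \<omega> *v Y \<omega>) (Y \<omega>)) = expectation (\<lambda>\<omega>. inner (expectation A *v Y \<omega>) (Y \<omega>))"
    unfolding expand
    by (simp add: int intY indep_var_lebesgue_integral[OF ind intA intY]
        integral_bounded_linear[OF entry A])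
qed

text \<open>By Tonelli the sum of the \<open>D k\<close> has finite expectation, so it is almost
  surely finite and its terms vanish in the limit.\<close>

lemma AE_tendsto_0_of_summable_expectation:
  fixes D :: "nat \<Rightarrow> 'a \<Rightarrow> real"
  assumes int: "\<And>k. integrable M (D k)" and nonneg: "\<And>k \<omega>. 0 \<le> D k \<omega>"
    and "summable (\<lambda>k. expectation (D k))"
  shows "AE \<omega> in M. (\<lambda>k. D k \<omega>) \<longlonglongrightarrow> 0"
proof -
  have [measurable]: "D k \<in> borel_measurable M" for k using int by auto
  have "(\<integral>\<^sup>+\<omega>. (\<Sum>k. ennreal (D k \<omega>)) \<partial>M) = (\<Sum>k. ennreal (expectation (D k)))"
    by (simp add: nn_integral_suminf nn_integral_eq_integral int nonneg)
  also have "\<dots> < \<infinity>"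
    using assms by (simp add: suminf_ennreal2)
  finally have "AE \<omega> in M. (\<Sum>k. ennreal (D k \<omega>)) \<noteq> \<infinity>"
    by (intro nn_integral_PInf_AE) auto
  then show ?thesis
    by eventually_elim (use nonneg in \<open>auto intro: summable_LIMSEQ_zero summable_suminf_not_top\<close>)
qed

end

theorem theorem1:
  fixes M :: "'w measure"
    and P :: "nat \<Rightarrow> 'w \<Rightarrow> real ^ 'l ^ 'd"
    and f :: "real ^ 'd \<Rightarrow> real"
    and grad_f :: "real ^ 'd \<Rightarrow> real ^ 'd"
    and f_star lam gam \<alpha> :: real
    and x0 :: "real ^ 'd"
    and X :: "nat \<Rightarrow> 'w \<Rightarrow> real ^ 'd"
  assumes "prob_space M"
    and dims: "CARD('l) \<le> CARD('d)"
    and P_indep: "prob_space.indep_vars M (\<lambda>_. borel) P UNIV"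
    and P_ident: "\<forall>k. distr M borel (P k) = distr M borel (P 0)"
    and P_mean: "\<forall>k. (LINT \<omega>|M. P k \<omega> ** transpose (P k \<omega>)) = mat 1"
    and P_orth: "\<forall>k. AE \<omega> in M. transpose (P k \<omega>) ** P k \<omega>
                   = (real CARD('d) / real CARD('l)) *\<^sub>R mat 1"
    and f_grad: "\<forall>x. GDERIV f x :> grad_f x"
    and grad_cont: "continuous_on UNIV grad_f"
    and lam_pos: "0 < lam"
    and grad_lipschitz: "lam-lipschitz_on UNIV grad_f"
    and f_star_attained: "\<exists>x. f x = f_star"
    and f_star_min: "\<forall>x. f_star \<le> f x"
    and gam_bounds: "0 < gam" "gam \<le> lam"
    and PL: "\<forall>x. f x - f_star \<le> (norm (grad_f x))\<^sup>2 / (2 * gam)"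
    and \<alpha>_bounds: "0 < \<alpha>" "\<alpha> < 2 * real CARD('l) / (real CARD('d) * lam)"
    and X_0: "\<forall>\<omega>\<in>space M. X 0 \<omega> = x0"
    and X_Suc: "\<forall>k. \<forall>\<omega>\<in>space M. X (Suc k) \<omega>
                  = X k \<omega> - \<alpha> *\<^sub>R ((P k \<omega> ** transpose (P k \<omega>)) *v grad_f (X k \<omega>))"
  shows "(AE \<omega> in M. (\<lambda>k. f (X k \<omega>)) \<longlonglongrightarrow> f_star)
       \<and> (\<forall>k. integrable M (\<lambda>\<omega>. f (X k \<omega>)))
       \<and> (\<lambda>k. LINT \<omega>|M. \<bar>f (X k \<omega>) - f_star\<bar>) \<longlonglongrightarrow> 0"
proof -
  interpret prob_space M by fact
  note grad = f_grad[rule_format]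
  define s where "s = real CARD('d) / real CARD('l)"
  \<comment> \<open>The gain of the linear term in the descent lemma less the cost of the quadratic
    one. For positive \<open>\<alpha>\<close> it is positive exactly when
    \<open>\<alpha> < 2 / (lam * s)\<close>, which is the assumed step size bound.\<close>
  define c where "c = \<alpha> - lam / 2 * \<alpha>\<^sup>2 * s"
  define A where "A k \<omega> = P k \<omega> ** transpose (P k \<omega>)" for k \<omega>
  define G where "G k \<omega> = grad_f (X k \<omega>)" for k \<omega>
  define D where "D k \<omega> = f (X k \<omega>) - f_star" for k \<omega>
  have "0 < s" by (simp add: s_def)
  have "c = \<alpha> * (1 - \<alpha> * (lam * s / 2))"
    by (simp add: c_def power2_eq_square algebra_simps)
  moreover have "\<alpha> * (lam * s / 2) < 1"
    using \<alpha>_bounds(2) lam_pos by (simp add: s_def field_simps)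
  ultimately have "0 < c" using \<alpha>_bounds(1) by simp
  have D_nonneg: "0 \<le> D k \<omega>" for k \<omega> using f_star_min by (simp add: D_def)

  \<comment> \<open>Measurability of the iterates and independence of \<open>P k\<close> from
    \<open>X k\<close>\<close>
  have meas_gram: "(\<lambda>p. p ** transpose p) \<in> borel_measurable (borel :: (real ^ 'l ^ 'd) measure)"
    unfolding matrix_matrix_mult_def transpose_def
    by (intro borel_measurable_continuous_onI) (auto intro!: continuous_intros)
  have meas_grad: "grad_f \<in> borel_measurable borel"
    by (intro borel_measurable_continuous_onI grad_cont)
  have "continuous_on UNIV (\<lambda>(p, x). x - \<alpha> *\<^sub>R (((p :: real ^ 'l ^ 'd) ** transpose p) *v grad_f x))"
    unfolding matrix_matrix_mult_def transpose_def matrix_vector_mult_def case_prod_beta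
    by (intro continuous_intros continuous_on_compose2[OF grad_cont]) auto
  then have meas_step: "(\<lambda>(p, x). x - \<alpha> *\<^sub>R ((p ** transpose p) *v grad_f x))
      \<in> measurable ((borel :: (real ^ 'l ^ 'd) measure) \<Otimes>\<^sub>M borel) borel"
    unfolding borel_prod by (rule borel_measurable_continuous_onI)
  have meas_X: "X k \<in> borel_measurable M" for k
    using X_0 X_Suc by (intro random_variable_random_recursion[OF P_indep meas_step, of x0]) auto
  have meas_G: "G k \<in> borel_measurable M" for k
    unfolding G_def[abs_def] by (rule measurable_compose[OF meas_X meas_grad])
  have "(\<lambda>p. (p ** transpose p) $ i $ j) \<in> borel_measurable (borel :: (real ^ 'l ^ 'd) measure)" for i j
    by (rule measurable_compose[OF meas_gram]) (intro borel_measurable_continuous_onI continuous_intros)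
  moreover have "(\<lambda>x. grad_f x $ i * grad_f x $ j) \<in> borel_measurable borel" for i j
    by (rule measurable_compose[OF meas_grad]) (intro borel_measurable_continuous_onI continuous_intros)
  ultimately have ind: "indep_var borel (\<lambda>\<omega>. A k \<omega> $ i $ j) borel (\<lambda>\<omega>. G k \<omega> $ i * G k \<omega> $ j)" for k i j
    unfolding A_def G_def
    using X_0 X_Suc by (intro indep_var_random_recursion[OF P_indep meas_step, of x0]) auto
  have "f differentiable at x" for x
    using grad unfolding gderiv_def differentiable_def by blast
  then have "continuous_on UNIV f"
    by (simp add: continuous_at_imp_continuous_on differentiable_imp_continuous_within)
  then have "f \<in> borel_measurable borel" by (rule borel_measurable_continuous_onI)
  from measurable_compose[OF meas_X this]
  have meas_D[measurable]: "D k \<in> borel_measurable M" for k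
    by (simp add: D_def[abs_def])

  \<comment> \<open>Almost sure descent, uniform bounds and integrability\<close>
  have descent: "AE \<omega> in M. D (Suc k) \<omega> \<le> D k \<omega> - c * inner (A k \<omega> *v G k \<omega>) (G k \<omega>)" for k
    using P_orth[rule_format, of k] AE_space
  proof eventually_elim
    case (elim \<omega>)
    define u where "u = A k \<omega> *v G k \<omega>"
    have "(norm u)\<^sup>2 = s * inner u (G k \<omega>)"
      unfolding u_def A_def by (rule norm_gram) (use elim(1) in \<open>simp add: s_def\<close>)
    moreover have "X (Suc k) \<omega> - X k \<omega> = - \<alpha> *\<^sub>R u"
      using elim(2) X_Suc by (simp add: u_def A_def G_def)
    ultimately have "f (X (Suc k) \<omega>)
        \<le> f (X k \<omega>) + inner (G k \<omega>) (- \<alpha> *\<^sub>R u) + lam / 2 * (\<alpha>\<^sup>2 * (s * inner u (G k \<omega>)))"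
      using lipschitz_gradient_descent[OF grad grad_lipschitz, of "X (Suc k) \<omega>" "X k \<omega>"]
      by (simp add: G_def power_mult_distrib)
    then have "f (X (Suc k) \<omega>) \<le> f (X k \<omega>) - c * inner u (G k \<omega>)"
      by (simp add: c_def inner_commute algebra_simps)
    then show ?case by (simp add: D_def u_def)
  qed
  \<comment> \<open>The decrease is a squared norm times \<open>c\<close>, so the gap never grows;
    as \<open>x0\<close> is deterministic, the bound is a constant and yields integrability.\<close>
  have D_bound: "AE \<omega> in M. D k \<omega> \<le> f x0 - f_star" for k
  proof (induction k)
    case 0
    show ?case using AE_space by eventually_elim (use X_0 in \<open>simp add: D_def\<close>)
  next
    case (Suc k)
    then show ?case using descent[of k]
    proof eventually_elim
      case (elim \<omega>)
      have "0 \<le> c * inner (A k \<omega> *v G k \<omega>) (G k \<omega>)"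
        using \<open>0 < c\<close> by (simp add: A_def inner_gram)
      with elim show ?case by linarith
    qed
  qed
  have int_D: "integrable M (D k)" for k
    by (rule integrable_const_bound[where B="f x0 - f_star"])
       (use D_bound D_nonneg in \<open>auto elim: eventually_mono\<close>)
  have G_bound: "AE \<omega> in M. norm (G k \<omega>) \<le> sqrt (2 * lam * (f x0 - f_star))" for k
    using D_bound[of k]
  proof eventually_elim
    case (elim \<omega>)
    have "(norm (G k \<omega>))\<^sup>2 \<le> 2 * lam * D k \<omega>"
      using lipschitz_gradient_norm_le[OF grad grad_lipschitz lam_pos] f_star_min
      by (simp add: G_def D_def)
    also have "\<dots> \<le> 2 * lam * (f x0 - f_star)" using elim lam_pos by simp
    finally show ?case by (rule real_le_rsqrt)
  qed
  text \<open>A nonintegrable \<open>A k\<close> would have the junk expectation 0, so \<open>P_mean\<close> yields integrability.\<close>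
  have "mat 1 \<noteq> (0 :: real ^ 'd ^ 'd)" by (simp add: vec_eq_iff mat_def)
  then have int_A: "integrable M (A k)" for k
    using P_mean not_integrable_integral_eq[of M "A k"] by (auto simp: A_def[abs_def])
  have mean_A: "expectation (A k) = mat 1" for k
    using P_mean by (simp add: A_def[abs_def])
  note int_q = integrable_quadratic_form_indep[OF ind int_A meas_G G_bound]
  have mean_q: "expectation (\<lambda>\<omega>. inner (A k \<omega> *v G k \<omega>) (G k \<omega>)) = expectation (\<lambda>\<omega>. (norm (G k \<omega>))\<^sup>2)" for k
    using expectation_quadratic_form_indep[OF ind int_A meas_G G_bound]
    by (simp add: mean_A power2_norm_eq_inner)
  have int_G: "integrable M (\<lambda>\<omega>. (norm (G k \<omega>))\<^sup>2)" for k
  proof (rule integrable_const_bound)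
    show "AE \<omega> in M. norm ((norm (G k \<omega>))\<^sup>2) \<le> (sqrt (2 * lam * (f x0 - f_star)))\<^sup>2"
      using G_bound[of k] by eventually_elim (simp only: real_norm_def abs_power2 norm_ge_zero power_mono)
    show "(\<lambda>\<omega>. (norm (G k \<omega>))\<^sup>2) \<in> borel_measurable M"
      using meas_G by measurable
  qed

  \<comment> \<open>Geometric decay of the expected gap and both modes of convergence\<close>
  define r where "r = max 0 (1 - 2 * gam * c)"
  \<comment> \<open>The factor \<open>1 - 2 * gam * c\<close> is what the Polyak-Lojasiewicz
    inequality gives; truncation at 0 ensures \<open>0 \<le> r\<close>, as iterating the contraction
    requires.\<close>
  have r: "0 \<le> r" "r < 1" using \<open>0 < c\<close> gam_bounds(1) by (auto simp: r_def)
  have contract: "expectation (D (Suc k)) \<le> r * expectation (D k)" for k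
  proof -
    have "2 * gam * expectation (D k) = expectation (\<lambda>\<omega>. 2 * gam * D k \<omega>)" by simp
    also have "\<dots> \<le> expectation (\<lambda>\<omega>. (norm (G k \<omega>))\<^sup>2)"
      using PL gam_bounds(1) by (intro integral_mono int_G integrable_mult_right int_D)
        (auto simp: D_def G_def field_simps)
    finally have "2 * gam * expectation (D k) \<le> expectation (\<lambda>\<omega>. (norm (G k \<omega>))\<^sup>2)" .
    then have PL': "c * (2 * gam * expectation (D k)) \<le> c * expectation (\<lambda>\<omega>. (norm (G k \<omega>))\<^sup>2)"
      using \<open>0 < c\<close> by simp
    have "expectation (D (Suc k)) \<le> expectation (\<lambda>\<omega>. D k \<omega> - c * inner (A k \<omega> *v G k \<omega>) (G k \<omega>))"
      by (intro integral_mono_AE descent int_D Bochner_Integration.integrable_diff integrable_mult_right int_q)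
    also have "\<dots> = expectation (D k) - c * expectation (\<lambda>\<omega>. (norm (G k \<omega>))\<^sup>2)"
      by (simp add: int_D int_q mean_q)
    also have "\<dots> \<le> (1 - 2 * gam * c) * expectation (D k)"
      using PL' by (simp add: algebra_simps)
    also have "\<dots> \<le> r * expectation (D k)"
      by (intro mult_right_mono) (auto simp: r_def D_nonneg)
    finally show ?thesis .
  qed
  have geometric: "expectation (D k) \<le> expectation (D 0) * r ^ k" for k
  proof (induction k)
    case (Suc k)
    have "expectation (D (Suc k)) \<le> r * expectation (D k)" by (rule contract)
    also have "\<dots> \<le> r * (expectation (D 0) * r ^ k)" using Suc r(1) by (rule mult_left_mono)
    finally show ?case by (simp add: mult_ac)
  qed simp
  have summable: "summable (\<lambda>k. expectation (D k))"
  proof (rule summable_comparison_test')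
    show "summable (\<lambda>k. expectation (D 0) * r ^ k)"
      using r by (intro summable_mult summable_geometric) simp
    show "norm (expectation (D k)) \<le> expectation (D 0) * r ^ k" if "0 \<le> k" for k
      using geometric[of k] by (simp add: D_nonneg)
  qed
  have "AE \<omega> in M. (\<lambda>k. f (X k \<omega>)) \<longlonglongrightarrow> f_star"
    using AE_tendsto_0_of_summable_expectation[OF int_D D_nonneg summable]
    by eventually_elim (simp add: D_def LIM_zero_iff)
  moreover have "integrable M (\<lambda>\<omega>. f (X k \<omega>))" for k
    using Bochner_Integration.integrable_add[OF int_D[of k] integrable_const[of f_star]]
    by (simp add: D_def)
  \<comment> \<open>As \<open>f_star\<close> is a lower bound, the absolute value is the gap itself,
    so these are the terms of the summable series.\<close>
  moreover have "(\<lambda>k. LINT \<omega>|M. \<bar>f (X k \<omega>) - f_star\<bar>) \<longlonglongrightarrow> 0"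
    using summable_LIMSEQ_zero[OF summable] f_star_min by (simp add: D_def[abs_def])
  ultimately show ?thesis by blast
qed

end
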